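(* Let $v_1,v_2,v_3\in\mathbb{R}$ and let $V=v_1\partial_x+v_2\partial_y+v_3\partial_z$ be the corresponding (constant) Killing vector field on the Galilean space $\mathbb{G}_3$. Let $\gamma(s)=(s,y(s),z(s))$, $s\in I$, with $y,z$ smooth on an interval $I\subset\mathbb{R}$ containing $0$, be a normal magnetic trajectory associated to $V$, i.e. $\ddot\gamma=V\times_{\mathbb{G}}\dot\gamma$ on $I$, satisfying the initial conditions $y(0)=y_0$, $\dot y(0)=Y_0$, $z(0)=z_0$, $\dot z(0)=Z_0$. Then $\gamma$ has one of the following forms: (i) if $V$ is isotropic (that is, $v_1=0$), $$\gamma(s)=\left(s,\ \frac{v_3}{2}s^2+Y_0s+y_0,\ -\frac{v_2}{2}s^2+Z_0s+z_0\right);$$ (ii) otherwise (that is, $v_1\neq 0$), $\gamma$ is the cylindrical helix on $S^1_{\mathbb{G}}(r)\times l$, where $S^1_{\mathbb{G}}(r)$ is a Euclidean circle in $\mathbb{G}_3$ with radius $$r=\sqrt{\left(\frac{Z_0}{v_1}-\frac{v_3}{v_1^2}\right)^2+\left(\frac{Y_0}{v_1}-\frac{v_2}{v_1^2}\right)^2}$$ and $l$ is the straight line $$s\mapsto\left(s,\ \frac{v_2}{v_1}s+\left(y_0-\frac{Z_0}{v_1}+\frac{v_3}{v_1^2}\right),\ \frac{v_3}{v_1}s+\left(z_0+\frac{Y_0}{v_1}-\frac{v_2}{v_1^2}\right)\right),$$ parametrized by $\gamma(s)=(s,y(s),z(s))$ with $$y(s)=\frac{Z_0-\frac{v_3}{v_1}}{v_1}\cos(v_1s)+\frac{Y_0-\frac{v_2}{v_1}}{v_1}\sin(v_1s)+\frac{v_2}{v_1}s+\left(y_0-\frac{Z_0-\frac{v_3}{v_1}}{v_1}\right),$$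 $$z(s)=\frac{Z_0-\frac{v_3}{v_1}}{v_1}\sin(v_1s)-\frac{Y_0-\frac{v_2}{v_1}}{v_1}\cos(v_1s)+\frac{v_3}{v_1}s+\left(z_0+\frac{Y_0-\frac{v_2}{v_1}}{v_1}\right).$$
   Context: The Galilean space $\mathbb{G}_3$ is $\mathbb{R}^3$ with coordinates $(x,y,z)$ and the Galilean scalar product: for $X=(x_1,x_2,x_3)$, $Y=(y_1,y_2,y_3)$, $\langle X,Y\rangle_{\mathbb{G}}=x_1y_1$ if $x_1\ne0$ or $y_1\neq 0$, and $\langle X,Y\rangle_{\mathbb{G}}=x_2y_2+x_3y_3$ if $x_1=y_1=0$. The norm is $\|X\|_{\mathbb{G}}=|x_1|$ if $x_1\neq0$ and $\|X\|_{\mathbb{G}}=\sqrt{x_2^2+x_3^2}$ if $x_1=0$. A vector $X$ is called isotropic if $x_1=0$ and non-isotropic if $x_1\neq 0$; the vector field $V=v_1\partial_x+v_2\partial_y+v_3\partial_z$ is identified with the vector $(v_1,v_2,v_3)$. The Galilean cross product is $$X\times_{\mathbb{G}}Y=\begin{cases}\left(0,\,-(x_1y_3-x_3y_1),\,x_1y_2-x_2y_1\right), & x_1\neq0\text{ or }y_1\neq0,\\ \left(x_2y_3-x_3y_2,\,0,\,0\right), & x_1=y_1=0.\end{cases}$$ A curve parametrized by Galilean arc length $s$ has the form $\gamma(s)=(s,y(s),z(s))$ (so it has unit speed). A normal magnetic trajectory associated to $V$ is such a unit-speed curve satisfying the Lorentz equation $\ddot\gamma=V\times_{\mathbb{G}}\dot\gamma$,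 where dots denote componentwise derivatives with respect to $s$. Planes $x=\text{const}$ are Euclidean planes; a Euclidean circle $S^1_{\mathbb{G}}(r)$ of radius $r$ is an ordinary circle of radius $r$ in such a plane. That $\gamma$ lies on $S^1_{\mathbb{G}}(r)\times l$ means that, for every $s$, the point $\gamma(s)$ lies in the plane $x=s$ at Euclidean distance $r$ from the point $l(s)$ of the line $l$ in that plane. *)

theory Defs
  imports "HOL-Analysis.Analysis"
begin

text \<open>The Galilean space is carried by \<^typ>\<open>real^3\<close>, with coordinates
  \<open>(x, y, z) = (p $ 1, p $ 2, p $ 3)\<close>.\<close>

definition isotropic :: "real^3 \<Rightarrow> bool" where
  "isotropic X \<longleftrightarrow> X $ 1 = 0"

definition galilean_cross :: "real^3 \<Rightarrow> real^3 \<Rightarrow> real^3" (infixr "\<times>\<^sub>G" 80) where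
  "X \<times>\<^sub>G Y =
    (if X $ 1 \<noteq> 0 \<or> Y $ 1 \<noteq> 0
     then vector [0, - (X $ 1 * Y $ 3 - X $ 3 * Y $ 1), X $ 1 * Y $ 2 - X $ 2 * Y $ 1]
     else vector [X $ 2 * Y $ 3 - X $ 3 * Y $ 2, 0, 0])"

text \<open>Derivatives on an interval \<open>I\<close> are taken within \<open>I\<close>, so they are one-sided at those
  endpoints that belong to \<open>I\<close>. For a curve in \<^typ>\<open>real^3\<close> with differentiable components,
  the derivative is the componentwise one.\<close>

definition deriv_on :: "real set \<Rightarrow> (real \<Rightarrow> 'a::real_normed_vector) \<Rightarrow> real \<Rightarrow> 'a" where
  "deriv_on I f = (\<lambda>s. vector_derivative f (at s within I))"

definition smooth_on :: "real set \<Rightarrow> (real \<Rightarrow> 'a::real_normed_vector) \<Rightarrow> bool" where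
  "smooth_on I f \<longleftrightarrow> (\<forall>n. \<forall>s\<in>I. (deriv_on I ^^ n) f differentiable (at s within I))"

text \<open>A smooth curve parametrized by Galilean arc length is one of the form
  \<open>s \<mapsto> (s, y s, z s)\<close> with \<open>y\<close> and \<open>z\<close> smooth.\<close>

definition arc_length_curve :: "real set \<Rightarrow> (real \<Rightarrow> real^3) \<Rightarrow> bool" where
  "arc_length_curve I \<gamma> \<longleftrightarrow>
    (\<forall>s\<in>I. \<gamma> s $ 1 = s) \<and> smooth_on I (\<lambda>s. \<gamma> s $ 2) \<and> smooth_on I (\<lambda>s. \<gamma> s $ 3)"

text \<open>A constant vector field is identified with its value \<open>V\<close>.\<close>

definition normal_magnetic_trajectory :: "real^3 \<Rightarrow> real set \<Rightarrow> (real \<Rightarrow> real^3) \<Rightarrow> bool" where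
  "normal_magnetic_trajectory V I \<gamma> \<longleftrightarrow>
    arc_length_curve I \<gamma> \<and>
    (\<forall>s\<in>I. deriv_on I (deriv_on I \<gamma>) s = V \<times>\<^sub>G deriv_on I \<gamma> s)"

text \<open>The circle with centre \<open>c\<close> and radius \<open>r\<close> in the plane \<open>x = c $ 1\<close>. On such a plane
  \<^const>\<open>dist\<close> is the planar Euclidean distance in the coordinates \<open>y\<close> and \<open>z\<close>.\<close>

definition euclidean_circle :: "real^3 \<Rightarrow> real \<Rightarrow> (real^3) set" where
  "euclidean_circle c r = {p. p $ 1 = c $ 1 \<and> dist p c = r}"

definition lies_on_circle_times_line ::
    "real set \<Rightarrow> (real \<Rightarrow> real^3) \<Rightarrow> real \<Rightarrow> (real \<Rightarrow> real^3) \<Rightarrow> bool" where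
  "lies_on_circle_times_line I \<gamma> r l \<longleftrightarrow>
    (\<forall>s\<in>I. \<gamma> s $ 1 = s \<and> l s $ 1 = s \<and> \<gamma> s \<in> euclidean_circle (l s) r)"

end

theory Submission
  imports Defs
begin

text \<open>Along \<open>\<gamma> s = (s, y s, z s)\<close> the velocity has first component \<open>1\<close>, so the cross product
  always takes its non-isotropic branch, whatever \<open>V\<close> is, and the Lorentz equation is the planar
  linear system \<open>y'' = v3 - v1 z'\<close>, \<open>z'' = v1 y' - v2\<close>
  (\<open>magnetic_trajectory_planar_lorentz\<close>). The magnetic term turns the velocity difference of two
  solutions by a right angle, so the length of that difference is conserved; solutions with equal
  initial data therefore coincide (\<open>planar_lorentz_unique\<close>). It remains to exhibit one solution
  with the right initial data: a parabola when \<open>v1 = 0\<close>, and a rotation at angular speed \<open>v1\<close>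
  around a uniformly moving centre when \<open>v1 \<noteq> 0\<close>. In the second case the centre describes the
  line \<open>l\<close> and the rotating vector has constant length \<open>r\<close>.\<close>

text \<open>The velocities \<open>y'\<close> and \<open>z'\<close> are separate arguments because on a one-point interval the
  derivative within \<open>I\<close> is not determined by the function.\<close>

definition planar_lorentz ::
    "real \<Rightarrow> real \<Rightarrow> real \<Rightarrow> real set \<Rightarrow> (real \<Rightarrow> real) \<Rightarrow> (real \<Rightarrow> real) \<Rightarrow>
     (real \<Rightarrow> real) \<Rightarrow> (real \<Rightarrow> real) \<Rightarrow> bool" where
  "planar_lorentz v1 v2 v3 I y y' z z' \<longleftrightarrow>
    (\<forall>s\<in>I. (y has_real_derivative y' s) (at s within I) \<and>
           (z has_real_derivative z' s) (at s within I) \<and>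
           (y' has_real_derivative (v3 - v1 * z' s)) (at s within I) \<and>
           (z' has_real_derivative (v1 * y' s - v2)) (at s within I))"

lemma zero_derivative_imp_eq:
  fixes f :: "real \<Rightarrow> real"
  assumes "convex I" "a \<in> I" "s \<in> I"
    and "\<And>t. t \<in> I \<Longrightarrow> (f has_real_derivative 0) (at t within I)"
  shows "f s = f a"
proof -
  obtain c where "\<And>t. t \<in> I \<Longrightarrow> f t = c"
    using has_field_derivative_zero_constant[OF assms(1,4)] by blast
  with assms show ?thesis by simp
qed

text \<open>For the differences \<open>u\<close>, \<open>w\<close> of two solutions the constant terms cancel, leaving
  \<open>u'' = - v1 w'\<close> and \<open>w'' = v1 u'\<close>. Then \<open>u'\<^sup>2 + w'\<^sup>2\<close> has derivative
  \<open>2 u' (- v1 w') + 2 w' (v1 u') = 0\<close>; it starts at \<open>0\<close>, so \<open>u'\<close> and \<open>w'\<close> vanish and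
  \<open>u\<close> and \<open>w\<close> keep their initial value \<open>0\<close>.\<close>

lemma planar_lorentz_unique:
  assumes "convex I" "a \<in> I" "s \<in> I"
    and sol: "planar_lorentz v1 v2 v3 I y y' z z'"
    and sol2: "planar_lorentz v1 v2 v3 I Y Y' Z Z'"
    and init: "y a = Y a" "y' a = Y' a" "z a = Z a" "z' a = Z' a"
  shows "y s = Y s" "z s = Z s"
proof -
  \<comment> \<open>the conserved squared length of the velocity difference\<close>
  let ?E = "\<lambda>t. (y' t - Y' t)\<^sup>2 + (z' t - Z' t)\<^sup>2"
  have d: "(y has_real_derivative y' t) (at t within I)"
     "(z has_real_derivative z' t) (at t within I)"
     "(y' has_real_derivative (v3 - v1 * z' t)) (at t within I)"
     "(z' has_real_derivative (v1 * y' t - v2)) (at t within I)"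
     "(Y has_real_derivative Y' t) (at t within I)"
     "(Z has_real_derivative Z' t) (at t within I)"
     "(Y' has_real_derivative (v3 - v1 * Z' t)) (at t within I)"
     "(Z' has_real_derivative (v1 * Y' t - v2)) (at t within I)" if "t \<in> I" for t
    using sol sol2 that by (auto simp: planar_lorentz_def)
  have vel: "y' t = Y' t" "z' t = Z' t" if t: "t \<in> I" for t
  proof -
    have "(?E has_real_derivative 0) (at r within I)" if "r \<in> I" for r
      by (rule derivative_eq_intros d[OF that] refl)+ (simp add: algebra_simps)
    then have "?E t = ?E a"
      by (rule zero_derivative_imp_eq[OF assms(1,2) t])
    also have "?E a = 0" by (simp add: init)
    finally show "y' t = Y' t" "z' t = Z' t" by (simp_all add: sum_power2_eq_zero_iff)
  qed
  have "((\<lambda>t. y t - Y t) has_real_derivative 0) (at t within I)" if "t \<in> I" for t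
    by (rule derivative_eq_intros d[OF that] refl)+ (simp add: vel that)
  then have "y s - Y s = y a - Y a"
    by (rule zero_derivative_imp_eq[OF assms(1-3)])
  then show "y s = Y s" by (simp add: init)
  have "((\<lambda>t. z t - Z t) has_real_derivative 0) (at t within I)" if "t \<in> I" for t
    by (rule derivative_eq_intros d[OF that] refl)+ (simp add: vel that)
  then have "z s - Z s = z a - Z a"
    by (rule zero_derivative_imp_eq[OF assms(1-3)])
  then show "z s = Z s" by (simp add: init)
qed

lemma planar_lorentz_parabola:
  "planar_lorentz 0 v2 v3 I
     (\<lambda>s. v3 / 2 * s^2 + Y0 * s + y0) (\<lambda>s. v3 * s + Y0)
     (\<lambda>s. - (v2 / 2) * s^2 + Z0 * s + z0) (\<lambda>s. - v2 * s + Z0)"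
  unfolding planar_lorentz_def
  by (auto intro!: derivative_eq_intros)

text \<open>The drift \<open>(v2 / v1, v3 / v1)\<close> is the velocity at which the right-hand side of the
  system vanishes; relative to it the velocity turns at constant angular speed \<open>v1\<close>.\<close>

lemma planar_lorentz_helix:
  assumes "v1 \<noteq> 0"
  shows "planar_lorentz v1 v2 v3 I
     (\<lambda>s. a * cos (v1 * s) + b * sin (v1 * s) + v2 / v1 * s + c)
     (\<lambda>s. v1 * (b * cos (v1 * s) - a * sin (v1 * s)) + v2 / v1)
     (\<lambda>s. a * sin (v1 * s) - b * cos (v1 * s) + v3 / v1 * s + d)
     (\<lambda>s. v1 * (a * cos (v1 * s) + b * sin (v1 * s)) + v3 / v1)"
  unfolding planar_lorentz_def using assms
  by (auto intro!: derivative_eq_intros simp: algebra_simps)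

lemma has_vector_derivative_vector3:
  fixes f g h :: "real \<Rightarrow> real"
  assumes "(f has_real_derivative a) F" "(g has_real_derivative b) F" "(h has_real_derivative c) F"
  shows "((\<lambda>s. vector [f s, g s, h s] :: real^3) has_vector_derivative vector [a, b, c]) F"
proof -
  have frame: "vector [p, q, r] = p *\<^sub>R axis 1 1 + q *\<^sub>R axis 2 1 + r *\<^sub>R (axis 3 1 :: real^3)"
    for p q r :: real
    by (simp add: vec_eq_iff forall_3 axis_def)
  show ?thesis
    unfolding frame using assms
    by (auto intro!: derivative_eq_intros simp: has_vector_derivative_def has_field_derivative_def
        fun_eq_iff algebra_simps)
qed

lemma deriv_on_eqI:
  assumes "(f has_vector_derivative d) (at s within I)" "at s within I \<noteq> bot"
  shows "deriv_on I f s = d"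
  unfolding deriv_on_def by (rule vector_derivative_within[OF assms(2,1)])

lemma smooth_on_imp_deriv:
  fixes f :: "real \<Rightarrow> real"
  assumes "smooth_on I f" "s \<in> I"
  shows "(f has_real_derivative deriv_on I f s) (at s within I)"
    and "(deriv_on I f has_real_derivative deriv_on I (deriv_on I f) s) (at s within I)"
proof -
  have "((deriv_on I ^^ n) f has_real_derivative deriv_on I ((deriv_on I ^^ n) f) s)
      (at s within I)" for n
    using assms unfolding smooth_on_def deriv_on_def has_real_derivative_iff_has_vector_derivative
    by (simp add: vector_derivative_works)
  from this[of 0] this[of 1]
  show "(f has_real_derivative deriv_on I f s) (at s within I)"
    and "(deriv_on I f has_real_derivative deriv_on I (deriv_on I f) s) (at s within I)"
    by simp_all
qed

text \<open>The Lorentz equation speaks of derivatives of the space curve; on a non-degenerate interval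
  these are unique and hence componentwise. On a one-point interval the filter \<open>at s within {s}\<close>
  is trivial, so every value is a derivative and the system holds vacuously.\<close>

lemma magnetic_trajectory_planar_lorentz:
  fixes y z :: "real \<Rightarrow> real"
  assumes "is_interval I"
    and mag: "normal_magnetic_trajectory (vector [v1, v2, v3]) I (\<lambda>s. vector [s, y s, z s])"
  shows "planar_lorentz v1 v2 v3 I y (deriv_on I y) z (deriv_on I z)"
proof -
  let ?\<gamma> = "\<lambda>s. vector [s, y s, z s] :: real^3"
  have "smooth_on I y" "smooth_on I z"
    using mag by (simp_all add: normal_magnetic_trajectory_def arc_length_curve_def)
  note dy = smooth_on_imp_deriv[OF this(1)] and dz = smooth_on_imp_deriv[OF this(2)]
  have second: "(deriv_on I y has_real_derivative (v3 - v1 * deriv_on I z s)) (at s within I) \<and>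
      (deriv_on I z has_real_derivative (v1 * deriv_on I y s - v2)) (at s within I)"
    if s: "s \<in> I" for s
  proof (cases "I = {s}")
    case True
    then have "at s within I = bot" by (simp add: at_within_eq_bot_iff)
    then show ?thesis by (simp add: has_field_derivative_def has_derivative_bot
      bounded_linear_mult_right)
  next
    case False
    have nontriv: "at t within I \<noteq> bot" if "t \<in> I" for t
      using connected_imp_perfect[of I t] is_interval_connected[OF assms(1)] that s False
      by (auto simp: trivial_limit_within)
    \<comment> \<open>The velocity must be known on all of \<open>I\<close>, since it is differentiated once more.\<close>
    have vel: "deriv_on I ?\<gamma> t = vector [1, deriv_on I y t, deriv_on I z t]" if "t \<in> I" for t
      by (intro deriv_on_eqI has_vector_derivative_vector3 DERIV_ident dy dz nontriv that)
    have "((\<lambda>t. vector [1, deriv_on I y t, deriv_on I z t] :: real^3) has_vector_derivative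
        vector [0, deriv_on I (deriv_on I y) s, deriv_on I (deriv_on I z) s]) (at s within I)"
      by (intro has_vector_derivative_vector3 DERIV_const dy dz s)
    then have "(deriv_on I ?\<gamma> has_vector_derivative
        vector [0, deriv_on I (deriv_on I y) s, deriv_on I (deriv_on I z) s]) (at s within I)"
      by (rule has_vector_derivative_transform[OF s vel, rotated])
    then have "deriv_on I (deriv_on I ?\<gamma>) s =
        vector [0, deriv_on I (deriv_on I y) s, deriv_on I (deriv_on I z) s]"
      by (rule deriv_on_eqI[OF _ nontriv[OF s]])
    moreover have "deriv_on I (deriv_on I ?\<gamma>) s = vector [v1, v2, v3] \<times>\<^sub>G deriv_on I ?\<gamma> s"
      using mag s by (simp add: normal_magnetic_trajectory_def)
    ultimately have "deriv_on I (deriv_on I y) s = v3 - v1 * deriv_on I z s \<and>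
        deriv_on I (deriv_on I z) s = v1 * deriv_on I y s - v2"
      by (simp add: vel s galilean_cross_def vec_eq_iff forall_3)
    then show ?thesis
      using dy(2)[OF s] dz(2)[OF s] by simp
  qed
  show ?thesis
    unfolding planar_lorentz_def using dy(1) dz(1) second by blast
qed

text \<open>A rotation matrix applied to \<open>(a, - b)\<close> preserves its length, hence the distance of the
  helix from its moving centre is constant.\<close>

lemma helix_on_circle:
  "(vector [s, a * cos t + b * sin t + p, a * sin t - b * cos t + q] :: real^3)
    \<in> euclidean_circle (vector [s, p, q]) (sqrt (a\<^sup>2 + b\<^sup>2))"
proof -
  have "(a * cos t + b * sin t)\<^sup>2 + (a * sin t - b * cos t)\<^sup>2
      = (a\<^sup>2 + b\<^sup>2) * ((cos t)\<^sup>2 + (sin t)\<^sup>2)"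
    by algebra
  then show ?thesis
    by (simp add: euclidean_circle_def dist_vec_def L2_set_def sum_3 dist_real_def)
qed

theorem theorem3p1:
  fixes v1 v2 v3 y0 Y0 z0 Z0 :: real
    and V :: "real^3"
    and I :: "real set"
    and y z :: "real \<Rightarrow> real"
    and \<gamma> :: "real \<Rightarrow> real^3"
  assumes V: "V = vector [v1, v2, v3]"
    and I: "is_interval I" "0 \<in> I"
    and \<gamma>: "\<gamma> = (\<lambda>s. vector [s, y s, z s])"
    and magnetic: "normal_magnetic_trajectory V I \<gamma>"
    and init: "y 0 = y0" "deriv_on I y 0 = Y0" "z 0 = z0" "deriv_on I z 0 = Z0"
  shows
    "(isotropic V \<longrightarrow>
       (\<forall>s\<in>I. \<gamma> s = vector [s, v3 / 2 * s^2 + Y0 * s + y0, - (v2 / 2) * s^2 + Z0 * s + z0])) \<and>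
     (\<not> isotropic V \<longrightarrow>
       lies_on_circle_times_line I \<gamma>
         (sqrt ((Z0 / v1 - v3 / v1^2)^2 + (Y0 / v1 - v2 / v1^2)^2))
         (\<lambda>s. vector [s, v2 / v1 * s + (y0 - Z0 / v1 + v3 / v1^2),
                         v3 / v1 * s + (z0 + Y0 / v1 - v2 / v1^2)]) \<and>
       (\<forall>s\<in>I.
         y s = (Z0 - v3 / v1) / v1 * cos (v1 * s) + (Y0 - v2 / v1) / v1 * sin (v1 * s)
               + v2 / v1 * s + (y0 - (Z0 - v3 / v1) / v1) \<and>
         z s = (Z0 - v3 / v1) / v1 * sin (v1 * s) - (Y0 - v2 / v1) / v1 * cos (v1 * s)
               + v3 / v1 * s + (z0 + (Y0 - v2 / v1) / v1)))"
proof -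
  have "convex I" using I(1) by (simp add: is_interval_convex)
  have sol: "planar_lorentz v1 v2 v3 I y (deriv_on I y) z (deriv_on I z)"
    using magnetic_trajectory_planar_lorentz[OF I(1)] magnetic unfolding V \<gamma> by blast
  have iso: "isotropic V \<longleftrightarrow> v1 = 0" by (simp add: V isotropic_def)
  note unique = planar_lorentz_unique[OF \<open>convex I\<close> I(2)]
  show ?thesis
  proof (intro conjI impI)
    assume "isotropic V"
    then have "planar_lorentz 0 v2 v3 I y (deriv_on I y) z (deriv_on I z)"
      using sol iso by simp
    note parabola = unique[OF _ this planar_lorentz_parabola[of v2 v3 I Y0 y0 Z0 z0]]
    show "\<forall>s\<in>I. \<gamma> s = vector [s, v3 / 2 * s^2 + Y0 * s + y0, - (v2 / 2) * s^2 + Z0 * s + z0]"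
    proof
      fix s assume "s \<in> I"
      then have "y s = v3 / 2 * s^2 + Y0 * s + y0" "z s = - (v2 / 2) * s^2 + Z0 * s + z0"
        using parabola init by simp_all
      then show "\<gamma> s = vector [s, v3 / 2 * s^2 + Y0 * s + y0, - (v2 / 2) * s^2 + Z0 * s + z0]"
        by (simp add: \<gamma>)
    qed
  next
    assume "\<not> isotropic V"
    with iso have "v1 \<noteq> 0" by simp
    \<comment> \<open>Coordinates of the rotating vector, fixed by matching the initial velocity;
      the centre then starts at \<open>(y0 - a, z0 + b)\<close>.\<close>
    define a where "a = (Z0 - v3 / v1) / v1"
    define b where "b = (Y0 - v2 / v1) / v1"
    have a: "v1 * a + v3 / v1 = Z0" and b: "v1 * b + v2 / v1 = Y0"
      using \<open>v1 \<noteq> 0\<close> by (simp_all add: a_def b_def)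
    have helix: "y s = a * cos (v1 * s) + b * sin (v1 * s) + v2 / v1 * s + (y0 - a)"
        "z s = a * sin (v1 * s) - b * cos (v1 * s) + v3 / v1 * s + (z0 + b)" if "s \<in> I" for s
      using unique[OF that sol planar_lorentz_helix[OF \<open>v1 \<noteq> 0\<close>, of v2 v3 I a b "y0 - a" "z0 + b"]]
        init a b by simp_all
    then show "\<forall>s\<in>I.
         y s = (Z0 - v3 / v1) / v1 * cos (v1 * s) + (Y0 - v2 / v1) / v1 * sin (v1 * s)
               + v2 / v1 * s + (y0 - (Z0 - v3 / v1) / v1) \<and>
         z s = (Z0 - v3 / v1) / v1 * sin (v1 * s) - (Y0 - v2 / v1) / v1 * cos (v1 * s)
               + v3 / v1 * s + (z0 + (Y0 - v2 / v1) / v1)"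
      unfolding a_def b_def by blast
    have a': "Z0 / v1 - v3 / v1^2 = a" and b': "Y0 / v1 - v2 / v1^2 = b"
      by (simp_all add: a_def b_def diff_divide_distrib power2_eq_square)
    have centre: "y0 - Z0 / v1 + v3 / v1^2 = y0 - a" "z0 + Y0 / v1 - v2 / v1^2 = z0 + b"
      using a' b' by linarith+
    show "lies_on_circle_times_line I \<gamma>
         (sqrt ((Z0 / v1 - v3 / v1^2)^2 + (Y0 / v1 - v2 / v1^2)^2))
         (\<lambda>s. vector [s, v2 / v1 * s + (y0 - Z0 / v1 + v3 / v1^2),
                         v3 / v1 * s + (z0 + Y0 / v1 - v2 / v1^2)])"
      unfolding a' b' centre lies_on_circle_times_line_def
    proof (intro ballI conjI)
      fix s assume s: "s \<in> I"
      show "\<gamma> s \<in> euclidean_circle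
          (vector [s, v2 / v1 * s + (y0 - a), v3 / v1 * s + (z0 + b)]) (sqrt (a\<^sup>2 + b\<^sup>2))"
        using helix_on_circle[of s a "v1 * s" b "v2 / v1 * s + (y0 - a)" "v3 / v1 * s + (z0 + b)"]
        by (simp add: \<gamma> helix[OF s] add.assoc)
    qed (simp_all add: \<gamma>)
  qed
qed

end
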